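(* Let $P(z)\in\mathbb{C}[z]$ be a non-constant polynomial in one variable with complex coefficients, let $\bar P$ be the polynomial whose coefficients are the complex conjugates of those of $P$, and let $f(x,y)\in\mathbb{R}[x,y]$ be the real polynomial given by $$f(x,y)=P(x+iy)\,\bar P(x-iy)-1.$$ Then $f(x,y)$ is reducible over $\mathbb{C}$ if and only if there exist an integer $d>1$ and a polynomial $P_1(z)\in\mathbb{C}[z]$ such that $P(z)=P_1(z)^d$.
   Context: A polynomial in two variables is reducible over $\mathbb{C}$ if it is a product of two non-constant polynomials in $\mathbb{C}[x,y]$. *)

theory Defs
  imports Complex_Main "HOL-Computational_Algebra.Polynomial"
begin

text \<open>Bivariate polynomials are nested univariate ones: the inner variable is \<open>x\<close>, the outer
  one is \<open>y\<close>, so the coefficient of \<open>x^i y^j\<close> in \<open>f\<close> is \<open>coeff (coeff f j) i\<close>.\<close>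

definition var_x :: "'a::comm_semiring_1 poly poly" where
  "var_x = [:[:0, 1:]:]"

definition var_y :: "'a::comm_semiring_1 poly poly" where
  "var_y = [:0, 1:]"

definition const2 :: "'a::zero \<Rightarrow> 'a poly poly" where
  "const2 c = [:[:c:]:]"

definition subst2 :: "'a::comm_semiring_1 poly \<Rightarrow> 'a poly poly \<Rightarrow> 'a poly poly" where
  "subst2 P q = poly (map_poly const2 P) q"

definition complexify :: "real poly poly \<Rightarrow> complex poly poly" where
  "complexify f = map_poly (map_poly complex_of_real) f"

definition reducible_over_C :: "complex poly poly \<Rightarrow> bool" where
  "reducible_over_C F \<longleftrightarrow>
     (\<exists>g h. g \<notin> range const2 \<and> h \<notin> range const2 \<and> F = g * h)"

definition curve_poly :: "complex poly \<Rightarrow> complex poly poly" where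
  "curve_poly P =
     subst2 P (var_x + const2 \<i> * var_y) *
     subst2 (map_poly cnj P) (var_x - const2 \<i> * var_y) - 1"

text \<open>The polynomial \<open>curve_poly P\<close> has real coefficients, i.e.\ it is the image of a
  unique element of \<open>\<real>[x, y]\<close>.\<close>

definition cnj2 :: "complex poly poly \<Rightarrow> complex poly poly" where
  "cnj2 F = map_poly (map_poly cnj) F"

lemma coeff_cnj2: "coeff (coeff (cnj2 F) j) i = cnj (coeff (coeff F j) i)"
  by (simp add: cnj2_def coeff_map_poly)

lemma coeff_complexify:
  "coeff (coeff (complexify f) j) i = complex_of_real (coeff (coeff f j) i)"
  by (simp add: complexify_def coeff_map_poly)

lemma poly2_eqI: "(\<And>i j. coeff (coeff F j) i = coeff (coeff G j) i) \<Longrightarrow> F = G"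
  by (simp add: poly_eq_iff)

lemma cnj2_add: "cnj2 (F + G) = cnj2 F + cnj2 G"
  by (rule poly2_eqI) (simp add: coeff_cnj2)

lemma cnj2_diff: "cnj2 (F - G) = cnj2 F - cnj2 G"
  by (rule poly2_eqI) (simp add: coeff_cnj2)

lemma cnj2_mult: "cnj2 (F * G) = cnj2 F * cnj2 G"
  by (rule poly2_eqI) (simp add: coeff_cnj2 coeff_mult coeff_sum)

lemma cnj2_const2: "cnj2 (const2 c) = const2 (cnj c)"
  by (simp add: cnj2_def const2_def map_poly_pCons)

lemma cnj2_1: "cnj2 1 = 1"
  using cnj2_const2[of 1] by (simp add: const2_def one_pCons)

lemma cnj2_var: "cnj2 var_x = var_x" "cnj2 var_y = var_y"
  by (simp_all add: cnj2_def var_x_def var_y_def map_poly_pCons)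

lemma cnj2_subst2: "cnj2 (subst2 P q) = subst2 (map_poly cnj P) (cnj2 q)"
proof (induction P)
  case 0
  show ?case by (simp add: subst2_def cnj2_def)
next
  case (pCons c P)
  have "const2 0 = (0 :: complex poly poly)" by (simp add: const2_def)
  then show ?case
    using pCons by (simp add: subst2_def map_poly_pCons cnj2_add cnj2_mult cnj2_const2)
qed

lemma cnj2_curve_poly: "cnj2 (curve_poly P) = curve_poly P"
proof -
  have minus: "const2 (- \<i>) = - const2 \<i>" by (simp add: const2_def)
  have "map_poly cnj (map_poly cnj P) = P" by (simp add: poly_eq_iff coeff_map_poly)
  then show ?thesis
    by (simp add: curve_poly_def cnj2_diff cnj2_mult cnj2_subst2 cnj2_add cnj2_const2 cnj2_1
        cnj2_var minus mult.commute)
qed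

lemma ex1_real_curve_poly: "\<exists>!f. complexify f = curve_poly P"
proof
  show "complexify (map_poly (map_poly Re) (curve_poly P)) = curve_poly P"
  proof (rule poly2_eqI)
    fix i j
    have "cnj (coeff (coeff (curve_poly P) j) i) = coeff (coeff (curve_poly P) j) i"
      by (metis coeff_cnj2 cnj2_curve_poly)
    then have "coeff (coeff (curve_poly P) j) i \<in> \<real>" by (simp add: Reals_cnj_iff)
    then show "coeff (coeff (complexify (map_poly (map_poly Re) (curve_poly P))) j) i
        = coeff (coeff (curve_poly P) j) i"
      by (simp add: coeff_complexify coeff_map_poly)
  qed
next
  fix f assume f: "complexify f = curve_poly P"
  show "f = map_poly (map_poly Re) (curve_poly P)"
    by (rule poly2_eqI) (simp add: f[symmetric] coeff_complexify coeff_map_poly)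
qed

end

theory Submission
  imports Defs "HOL-Computational_Algebra.Fundamental_Theorem_Algebra"
begin

text \<open>In the coordinates \<open>u = x + \<i>y\<close>, \<open>v = x - \<i>y\<close> the polynomial becomes \<open>P(u) Q(v) - 1\<close> with
  \<open>Q\<close> the conjugate of \<open>P\<close>, of degree \<open>n\<close>. Suppose it equals \<open>G H\<close>, where \<open>G\<close> has degree \<open>m\<close> in \<open>v\<close>
  and leading coefficient \<open>g(u)\<close>. At a root \<open>b\<close> of \<open>Q\<close> we get \<open>G(u,b) H(u,b) = -1\<close>, so \<open>G(u,b)\<close> does
  not depend on \<open>u\<close>. On the other hand the product of the \<open>G(u,b)\<close> over the roots \<open>b\<close> of \<open>Q\<close> is, up to
  a constant, the resultant \<open>g(u)^n \<Prod> Q(v\<^sub>i)\<close>, where \<open>v\<^sub>1, \<dots>, v\<^sub>m\<close> are the roots of \<open>G(u,\<cdot>)\<close>, and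
  \<open>Q(v\<^sub>i) = 1 / P(u)\<close>. Hence \<open>g^n = K P^m\<close> for a constant \<open>K \<noteq> 0\<close>. If neither factor is constant,
  then \<open>0 < m < n\<close>, and \<open>n div gcd n m > 1\<close> divides the multiplicity of every root of \<open>P\<close>.\<close>

section \<open>Evaluation and change of coordinates for bivariate polynomials\<close>

definition poly2 :: "'a::comm_semiring_1 poly poly \<Rightarrow> 'a \<Rightarrow> 'a \<Rightarrow> 'a" where
  "poly2 F x y = poly (poly F [:y:]) x"

lemma poly2_simps [simp]:
  fixes F G :: "'a::comm_ring_1 poly poly"
  shows "poly2 (F + G) x y = poly2 F x y + poly2 G x y"
    and "poly2 (F - G) x y = poly2 F x y - poly2 G x y"
    and "poly2 (F * G) x y = poly2 F x y * poly2 G x y"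
    and "poly2 (F ^ k) x y = poly2 F x y ^ k"
    and "poly2 0 x y = (0::'a)"
    and "poly2 1 x y = (1::'a)"
    and "poly2 (const2 c) x y = (c::'a)"
    and "poly2 var_x x y = (x::'a)"
    and "poly2 var_y x y = (y::'a)"
    and "poly2 (pCons p F) x y = poly p x + y * poly2 F x y"
    and "poly2 (sum R A) x y = (\<Sum>k\<in>A. poly2 (R k) x y)"
  by (simp_all add: poly2_def const2_def var_x_def var_y_def poly_sum)

lemma poly2_subst2 [simp]:
  fixes q :: "'a::comm_ring_1 poly poly"
  shows "poly2 (subst2 P q) x y = poly P (poly2 q x y)"
proof (induction P)
  case (pCons c P)
  have "const2 0 = (0 :: 'a poly poly)" by (simp add: const2_def)
  with pCons show ?case by (simp add: subst2_def map_poly_pCons)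
qed (simp add: subst2_def)

text \<open>Read in the outer variable, \<open>F - G\<close> has the infinitely many roots
  \<open>[:y:]\<close>, so it vanishes.\<close>

lemma poly2_eqI:
  fixes F G :: "'a::field_char_0 poly poly"
  assumes "\<And>x y. poly2 F x y = poly2 G x y"
  shows "F = G"
proof (rule ccontr)
  assume "F \<noteq> G"
  then have "finite {p. poly (F - G) p = 0}" by (intro poly_roots_finite) simp
  moreover have "range (\<lambda>y. [:y:]) \<subseteq> {p. poly (F - G) p = 0}"
  proof clarify
    fix y
    have "poly (poly F [:y:]) = poly (poly G [:y:])"
      using assms by (auto simp: poly2_def)
    then show "poly (F - G) [:y:] = 0" by (simp add: poly_eq_poly_eq_iff)
  qed
  ultimately have "finite (range (\<lambda>y::'a. [:y:]))" by (rule rev_finite_subset)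
  moreover have "inj (\<lambda>y::'a. [:y:])" by (simp add: inj_def)
  ultimately show False using finite_imageD infinite_UNIV_char_0 by blast
qed

lemma poly2_constant_iff:
  fixes F :: "'a::field_char_0 poly poly"
  shows "F \<in> range const2 \<longleftrightarrow> (\<exists>c. \<forall>x y. poly2 F x y = c)"
proof
  assume "\<exists>c. \<forall>x y. poly2 F x y = c"
  then obtain c where "\<And>x y. poly2 F x y = c" by blast
  then have "F = const2 c" by (intro poly2_eqI) simp
  then show "F \<in> range const2" by blast
qed auto

text \<open>Horner's scheme in the outer variable builds \<open>F'\<close>. It carries a
  factorization from the coordinates \<open>x\<close>, \<open>y\<close> to \<open>u\<close>,
  \<open>v\<close>.\<close>

lemma poly2_change_of_variables:
  fixes F A B :: "'a::comm_ring_1 poly poly"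
  obtains F' where "\<And>u v. poly2 F' u v = poly2 F (poly2 A u v) (poly2 B u v)"
proof -
  have "\<exists>F'. \<forall>u v. poly2 F' u v = poly2 F (poly2 A u v) (poly2 B u v)"
  proof (induction F)
    case 0
    show ?case by (intro exI[of _ 0]) simp
  next
    case (pCons p F)
    then obtain F' where "\<And>u v. poly2 F' u v = poly2 F (poly2 A u v) (poly2 B u v)" by blast
    then show ?case by (intro exI[of _ "subst2 p A + B * F'"]) simp
  qed
  then show thesis using that by blast
qed

text \<open>With \<open>x\<close> frozen, this leaves a univariate polynomial, which splits into
  linear factors over the complex numbers.\<close>

lemma poly2_eq_poly_map_poly:
  "poly2 F x y = poly (map_poly (\<lambda>p. poly p x) F) (y::'a::comm_ring_1)"
  by (induction F) (simp_all add: map_poly_pCons)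

section \<open>Leading coefficient of a factor, by a resultant\<close>

lemma poly_factor_constant:
  fixes p q :: "'a::field_char_0 poly"
  assumes "\<And>x. poly p x * poly q x = c" and "c \<noteq> 0"
  shows "degree p = 0"
proof -
  have "poly (p * q) = poly [:c:]" using assms(1) by (intro ext) simp
  then have "p * q = [:c:]" by (simp only: poly_eq_poly_eq_iff)
  with \<open>c \<noteq> 0\<close> show ?thesis
    by (metis degree_mult_eq degree_pCons_0 add_is_0 mult_eq_0_iff pCons_eq_0_iff)
qed

text \<open>The degree and leading coefficient of a nested polynomial refer to the outer variable \<open>v\<close>.\<close>

lemma lead_coeff_power_of_factor:
  fixes P Q :: "complex poly" and G H :: "complex poly poly"
  assumes "Q \<noteq> 0" and "P \<noteq> 0" and G0: "lead_coeff G dvd P"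
    and GH: "\<And>u v. poly2 G u v * poly2 H u v = poly P u * poly Q v - 1"
  obtains K where "K \<noteq> 0" and "lead_coeff G ^ degree Q = smult K (P ^ degree G)"
proof -
  define g n m where "g = lead_coeff G" and "n = degree Q" and "m = degree G"
  define q where "q = lead_coeff Q"
  have q: "q \<noteq> 0" using \<open>Q \<noteq> 0\<close> by (simp add: q_def)
  obtain B where B: "size B = n" "Q = smult q (\<Prod>b\<in>#B. [:-b, 1:])"
    unfolding n_def q_def using alg_closed_imp_factorization[OF \<open>Q \<noteq> 0\<close>] by metis
  have polyQ: "poly Q x = q * (\<Prod>b\<in>#B. x - b)" for x
    by (subst B(2)) (simp add: poly_prod_mset)
  define C where "C = (\<Prod>b\<in>#B. poly2 G 0 b)"
  have const: "poly2 G u b = poly2 G 0 b" and nz: "poly2 G u b \<noteq> 0" if "b \<in># B" for u b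
  proof -
    have "poly Q b = 0"
      using that by (simp add: polyQ)
    then have prod: "poly2 G x b * poly2 H x b = -1" for x by (simp add: GH)
    then have "degree (poly G [:b:]) = 0"
      by (intro poly_factor_constant[of _ "poly H [:b:]" "-1"]) (simp_all add: poly2_def)
    then obtain c where "poly G [:b:] = [:c:]" by (rule degree_eq_zeroE)
    then show "poly2 G u b = poly2 G 0 b" by (simp add: poly2_def)
    show "poly2 G u b \<noteq> 0" using prod[of u] by auto
  qed
  have "C \<noteq> 0" using nz by (auto simp: C_def)
  \<comment> \<open>This value comes from solving
    \<open>C = g(u)^n * ((-1)^n / (q * P(u)))^m\<close> for \<open>g(u)^n\<close>.\<close>
  define K where "K = C * ((-1) ^ n * q) ^ m"
  have eq: "poly g u ^ n = K * poly P u ^ m" if "poly P u \<noteq> 0" for u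
  proof -
    let ?G = "map_poly (\<lambda>p. poly p u) G"
    \<comment> \<open>As \<open>g\<close> divides \<open>P\<close>, the degree in \<open>v\<close>
      does not drop when \<open>u\<close> is specialized away from the roots of
      \<open>P\<close>.\<close>
    have "poly g u \<noteq> 0" using G0 that unfolding g_def by (auto elim!: dvdE)
    then have deg: "degree ?G = m" unfolding m_def g_def by (intro map_poly_degree_eq)
    then have lc: "lead_coeff ?G = poly g u"
      by (simp add: coeff_map_poly g_def m_def)
    have "?G \<noteq> 0" using lc \<open>poly g u \<noteq> 0\<close> by auto
    then obtain A where A: "size A = m" "?G = smult (poly g u) (\<Prod>a\<in>#A. [:-a, 1:])"
      using alg_closed_imp_factorization lc deg by metis
    have polyG: "poly2 G u v = poly g u * (\<Prod>a\<in>#A. v - a)" for v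
      unfolding poly2_eq_poly_map_poly by (subst A(2)) (simp add: poly_prod_mset)
    \<comment> \<open>Where \<open>G(u,a) = 0\<close>, the factorization forces
      \<open>P(u) * Q(a) = 1\<close>; the sign comes from reversing \<open>n\<close>
      differences.\<close>
    have root: "(\<Prod>b\<in>#B. b - a) = (-1) ^ n / (q * poly P u)" if "a \<in># A" for a
    proof -
      have "poly2 G u a = 0" using that by (simp add: polyG)
      then have "poly P u * poly Q a = 1" using GH[of u a] by simp
      then have 1: "(\<Prod>b\<in>#B. a - b) = 1 / (q * poly P u)"
        using q \<open>poly P u \<noteq> 0\<close> by (simp add: polyQ field_simps)
      have "(\<Prod>b\<in>#B. b - a) = (\<Prod>b\<in>#B. (-1) * (a - b))" by simp
      also have "\<dots> = (-1) ^ n * (\<Prod>b\<in>#B. a - b)"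
        by (subst prod_mset.distrib) (simp add: B(1))
      finally show ?thesis by (simp add: 1)
    qed
    have "C = (\<Prod>b\<in>#B. poly2 G u b)"
      unfolding C_def by (metis (no_types, lifting) const image_mset_cong)
    also have "\<dots> = poly g u ^ n * (\<Prod>b\<in>#B. \<Prod>a\<in>#A. b - a)"
      unfolding polyG by (subst prod_mset.distrib) (simp add: B(1))
    also have "(\<Prod>b\<in>#B. \<Prod>a\<in>#A. b - a) = (\<Prod>a\<in>#A. \<Prod>b\<in>#B. b - a)"
      by (rule prod_mset.swap)
    also have "\<dots> = (\<Prod>a\<in>#A. (-1) ^ n / (q * poly P u))"
      using root by (metis (no_types, lifting) image_mset_cong)
    also have "\<dots> = ((-1) ^ n / (q * poly P u)) ^ m" by (simp add: A(1))
    finally have "C = poly g u ^ n * ((-1) ^ n / (q * poly P u)) ^ m" .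
    then have "K * poly P u ^ m
        = poly g u ^ n * ((-1) ^ n / (q * poly P u) * ((-1) ^ n * q) * poly P u) ^ m"
      by (simp only: K_def power_mult_distrib mult.assoc)
    also have "(-1) ^ n / (q * poly P u) * ((-1) ^ n * q) * poly P u = (-1) ^ n * (-1) ^ n"
      using q that by simp
    also have "\<dots> = 1"
      by (simp flip: power_mult_distrib)
    finally show ?thesis by simp
  qed
  \<comment> \<open>The extra factor \<open>P\<close> covers its own roots, where \<open>eq\<close>
    says nothing; it is cancelled afterwards.\<close>
  have "poly (P * (g ^ n - smult K (P ^ m))) u = poly 0 u" for u
    using eq[of u] by (cases "poly P u = 0") simp_all
  then have "P * (g ^ n - smult K (P ^ m)) = 0"
    by (metis poly_eq_poly_eq_iff ext)
  then have "g ^ n = smult K (P ^ m)" using \<open>P \<noteq> 0\<close> by simp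
  moreover have "K \<noteq> 0" using \<open>C \<noteq> 0\<close> q by (simp add: K_def)
  ultimately show thesis using that unfolding g_def n_def m_def by blast
qed

section \<open>Perfect powers and root multiplicities\<close>

lemma poly_is_power_if_dvd_order:
  fixes P :: "complex poly"
  assumes "d > 0" and "\<And>z. d dvd order z P"
  shows "\<exists>P1. P = P1 ^ d"
proof -
  obtain c where c: "c ^ d = lead_coeff P"
    using nth_root_exists[OF \<open>d > 0\<close>] by metis
  \<comment> \<open>All multiplicities are divided by \<open>d\<close>, and \<open>c\<close> is a
    \<open>d\<close>-th root of the leading coefficient.\<close>
  define P1 where "P1 = smult c (\<Prod>z | poly P z = 0. [:-z, 1:] ^ (order z P div d))"
  have "P1 ^ d = smult (lead_coeff P) (\<Prod>z | poly P z = 0. [:-z, 1:] ^ order z P)"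
    using assms(2) by (simp add: P1_def smult_power c prod_power_distrib flip: power_mult)
  then show ?thesis by (metis complex_poly_decompose)
qed

lemma order_power:
  fixes p :: "'a::idom poly"
  assumes "p \<noteq> 0"
  shows "order z (p ^ k) = k * order z p"
  using assms by (induction k) (simp_all add: order_mult order_1_eq_0)

text \<open>Comparing multiplicities gives \<open>n * order z g = m * order z P\<close>; after
  division by \<open>gcd n m\<close>, coprimality makes \<open>d\<close> divide
  \<open>order z P\<close>.\<close>

lemma poly_is_power_if_power_eq:
  fixes P g :: "complex poly"
  assumes "P \<noteq> 0" and "K \<noteq> 0" and eq: "g ^ n = smult K (P ^ m)" and "0 < m" "m < n"
  shows "\<exists>d P1. d > 1 \<and> P = P1 ^ d"
proof -
  define d where "d = n div gcd n m"
  have d: "n = d * gcd n m" by (simp add: d_def)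
  have "gcd n m \<le> m" using \<open>0 < m\<close> by (intro dvd_imp_le) auto
  then have "d > 1"
    using d \<open>m < n\<close> by (metis One_nat_def Suc_lessI leD less_imp_le mult_0 mult_1 nat_neq_iff not_less0)
  have "g \<noteq> 0" using assms by (metis power_eq_0_iff smult_eq_0_iff not_less_zero zero_power less_trans)
  have "d dvd order z P" for z
  proof -
    have "n * order z g = m * order z P"
      using arg_cong[OF eq, of "order z"] \<open>g \<noteq> 0\<close> \<open>P \<noteq> 0\<close> \<open>K \<noteq> 0\<close>
      by (simp add: order_power order_smult)
    then have "n dvd m * order z P" by (metis dvd_triv_left)
    moreover have "m * order z P = (m div gcd n m) * order z P * gcd n m"
      by (metis dvd_div_mult_self gcd_dvd2 mult.assoc mult.commute)
    ultimately have "d * gcd n m dvd (m div gcd n m) * order z P * gcd n m"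
      by (metis d)
    then have "d dvd (m div gcd n m) * order z P"
      using \<open>0 < m\<close> by simp
    moreover have "coprime d (m div gcd n m)"
      unfolding d_def using \<open>0 < m\<close> by (intro div_gcd_coprime) simp
    ultimately show ?thesis by (simp add: coprime_dvd_mult_right_iff)
  qed
  then show ?thesis using poly_is_power_if_dvd_order[of d P] \<open>d > 1\<close> by auto
qed

section \<open>The two implications\<close>

lemma degree_diff_eq_left:
  fixes p q :: "'a::ab_group_add poly"
  shows "degree q < degree p \<Longrightarrow> degree (p - q) = degree p"
  using degree_add_eq_left[of "- q" p] by simp

lemma is_power_if_separated_factor:
  fixes P Q :: "complex poly" and G H :: "complex poly poly"
  assumes degP: "degree P > 0" and degQ: "degree Q > 0"
    and GH: "\<And>u v. poly2 G u v * poly2 H u v = poly P u * poly Q v - 1"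
    and G: "G \<notin> range const2" and H: "H \<notin> range const2"
  shows "\<exists>d P1. d > 1 \<and> P = P1 ^ d"
proof -
  have nz: "P \<noteq> 0" "Q \<noteq> 0" using degP degQ by auto
  \<comment> \<open>This is \<open>P(u) * Q(v) - 1\<close> as a polynomial in \<open>v\<close>.
    Since \<open>degree Q > 0\<close>, subtracting 1 leaves its leading coefficient a multiple of
    \<open>P\<close>.\<close>
  define F where "F = map_poly (\<lambda>c. smult c P) Q - 1"
  have "poly2 (map_poly (\<lambda>c. smult c P) R) u v = poly P u * poly R v" for u v R
    by (induction R) (simp_all add: map_poly_pCons algebra_simps)
  then have "G * H = F"
    by (intro poly2_eqI) (simp add: GH F_def)
  moreover have "degree (map_poly (\<lambda>c. smult c P) Q) = degree Q"
    using nz by (intro degree_map_poly) auto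
  then have degF: "degree F = degree Q" and lcF: "lead_coeff F = smult (lead_coeff Q) P"
    using degQ by (simp_all add: F_def degree_diff_eq_left coeff_map_poly)
  ultimately have lc: "lead_coeff G * lead_coeff H = smult (lead_coeff Q) P"
    by (metis lead_coeff_mult)
  have "F \<noteq> 0" using degF degQ by auto
  then have deg: "degree G + degree H = degree Q"
    using degF \<open>G * H = F\<close> by (metis degree_mult_eq mult_eq_0_iff)
  have dvd: "lead_coeff G dvd P" "lead_coeff H dvd P"
    using lc nz by (metis dvd_smult_cancel dvd_triv_left dvd_triv_right leading_coeff_0_iff)+
  \<comment> \<open>A factor free of \<open>v\<close> is its own leading coefficient, and some power
    of that is a constant.\<close>
  have const: "R \<in> range const2"
    if "K \<noteq> 0" "lead_coeff R ^ degree Q = smult K (P ^ degree R)" "degree R = 0"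
    for R :: "complex poly poly" and K
  proof -
    obtain r where r: "R = [:r:]" using \<open>degree R = 0\<close> by (rule degree_eq_zeroE)
    then have "r ^ degree Q = [:K:]" using that by simp
    then have "degree Q * degree r = 0"
      by (metis degree_pCons_0 degree_power_eq power_eq_0_iff degQ degree_0 mult_0_right)
    then obtain c where "r = [:c:]" using degQ degree_eq_zeroE by (metis mult_is_0 not_less_zero)
    then show ?thesis by (simp add: r const2_def)
  qed
  obtain K where K: "K \<noteq> 0" "lead_coeff G ^ degree Q = smult K (P ^ degree G)"
    using lead_coeff_power_of_factor[OF nz(2,1) dvd(1) GH] .
  obtain L where L: "L \<noteq> 0" "lead_coeff H ^ degree Q = smult L (P ^ degree H)"
    using lead_coeff_power_of_factor[OF nz(2,1) dvd(2), of G] GH by (metis mult.commute)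
  \<comment> \<open>Both degrees are positive with sum \<open>degree Q\<close>, so
    \<open>0 < degree G < degree Q\<close>.\<close>
  have "degree G \<noteq> 0" "degree H \<noteq> 0" using const K L G H by blast+
  then show ?thesis
    using poly_is_power_if_power_eq[OF nz(1) K] deg by simp
qed

text \<open>The factorization is \<open>(R - 1) * (\<Sum>k<d. R ^ k)\<close>. Neither factor is
  constant, because \<open>R\<close> takes every complex value.\<close>

lemma reducible_if_is_power:
  fixes P1 Q1 :: "complex poly"
  assumes "degree P1 > 0" and "Q1 \<noteq> 0" and "d > 1"
    and R: "\<And>x y. poly2 R x y = poly P1 (x + \<i> * y) * poly Q1 (x - \<i> * y)"
  shows "reducible_over_C (R ^ d - 1)"
proof -
  obtain v where v: "poly Q1 v \<noteq> 0" using \<open>Q1 \<noteq> 0\<close> poly_all_0_iff_0 by blast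
  have surj: "\<exists>x y. poly2 R x y = r" for r
  proof -
    \<comment> \<open>With \<open>v\<close> fixed, it remains to solve
      \<open>P1(u) = r / Q1(v)\<close> for \<open>u\<close> and return to the coordinates
      \<open>x\<close>, \<open>y\<close>.\<close>
    have "degree (P1 - [:r / poly Q1 v:]) \<noteq> 0"
      using assms(1) by (simp add: degree_diff_eq_left)
    then obtain u where "poly (P1 - [:r / poly Q1 v:]) u = 0"
      using fundamental_theorem_of_algebra constant_degree by metis
    then have "poly P1 u * poly Q1 v = r" using v by simp
    moreover have "(u + v) / 2 + \<i> * ((u - v) / (2 * \<i>)) = u"
      "(u + v) / 2 - \<i> * ((u - v) / (2 * \<i>)) = v"
      by (simp_all add: field_simps)
    ultimately have "poly2 R ((u + v) / 2) ((u - v) / (2 * \<i>)) = r" by (simp only: R)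
    then show ?thesis by blast
  qed
  have "R - 1 \<notin> range const2"
  proof
    assume "R - 1 \<in> range const2"
    then obtain c where "\<And>x y. poly2 R x y - 1 = c"
      unfolding poly2_constant_iff by auto
    then have "r = c + 1" for r using surj[of r] by (metis diff_add_cancel)
    from this[of 0] this[of 1] show False by simp
  qed
  moreover have "(\<Sum>k<d. R ^ k) \<notin> range const2"
  proof
    assume "(\<Sum>k<d. R ^ k) \<in> range const2"
    then obtain c where c: "\<And>x y. (\<Sum>k<d. poly2 R x y ^ k) = c"
      unfolding poly2_constant_iff by auto
    have "(\<Sum>k<d. (r::complex) ^ k) = c" for r using c surj[of r] by blast
    \<comment> \<open>At 0 only the term \<open>k = 0\<close> survives, giving 1; at 1 the sum is
      \<open>d\<close>.\<close>
    from this[of 0] this[of 1] have "(\<Sum>k<d. (0::complex) ^ k) = (\<Sum>k<d. 1 ^ k)"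
      by (rule trans[OF _ sym])
    then show False using \<open>d > 1\<close> by (simp add: power_0_left)
  qed
  ultimately show ?thesis
    unfolding reducible_over_C_def using power_diff_1_eq[of R d] by blast
qed

theorem corollary1:
  fixes P :: "complex poly" and f :: "real poly poly"
  assumes "degree P > 0"
    and "complexify f =
           subst2 P (var_x + const2 \<i> * var_y) *
           subst2 (map_poly cnj P) (var_x - const2 \<i> * var_y) - 1"
  shows "reducible_over_C (complexify f) \<longleftrightarrow>
           (\<exists>(d::nat) (P1::complex poly). d > 1 \<and> P = P1 ^ d)"
proof
  assume "reducible_over_C (complexify f)"
  then obtain g h where gh: "g \<notin> range const2" "h \<notin> range const2" "complexify f = g * h"
    unfolding reducible_over_C_def by blast
  \<comment> \<open>The inverse substitution \<open>x = (u + v) / 2\<close>,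
    \<open>y = (u - v) / (2 * \<i>)\<close>; here \<open>var_x\<close> and \<open>var_y\<close>
    stand for \<open>u\<close> and \<open>v\<close>.\<close>
  define X Y :: "complex poly poly"
    where "X = const2 (1/2) * (var_x + var_y)" and "Y = const2 (1 / (2 * \<i>)) * (var_x - var_y)"
  obtain G where G: "\<And>u v. poly2 G u v = poly2 g (poly2 X u v) (poly2 Y u v)"
    using poly2_change_of_variables[of g X Y] by blast
  obtain H where H: "\<And>u v. poly2 H u v = poly2 h (poly2 X u v) (poly2 Y u v)"
    using poly2_change_of_variables[of h X Y] by blast
  have uv: "poly2 X u v + \<i> * poly2 Y u v = u" "poly2 X u v - \<i> * poly2 Y u v = v" for u v
    by (simp_all add: X_def Y_def field_simps)
  have xy: "poly2 X (x + \<i> * y) (x - \<i> * y) = x" "poly2 Y (x + \<i> * y) (x - \<i> * y) = y" for x y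
    by (simp_all add: X_def Y_def field_simps)
  have gh_eq: "poly2 g x y * poly2 h x y
      = poly P (x + \<i> * y) * poly (map_poly cnj P) (x - \<i> * y) - 1" for x y
    using arg_cong[OF assms(2), of "\<lambda>F. poly2 F x y"] by (simp add: gh(3))
  \<comment> \<open>Every point \<open>(x, y)\<close> has coordinates \<open>(u, v)\<close>, so a
    constant \<open>F'\<close> would make \<open>F\<close> constant.\<close>
  have transfer: "F' \<notin> range const2"
    if "F \<notin> range const2" and F': "\<And>u v. poly2 F' u v = poly2 F (poly2 X u v) (poly2 Y u v)" for F F'
  proof
    assume "F' \<in> range const2"
    then obtain c where c: "\<And>u v. poly2 F' u v = c" unfolding poly2_constant_iff by blast
    have "poly2 F x y = c" for x y
      using c[of "x + \<i> * y" "x - \<i> * y"] by (simp only: F' xy)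
    with that(1) show False unfolding poly2_constant_iff by blast
  qed
  have "poly2 G u v * poly2 H u v = poly P u * poly (map_poly cnj P) v - 1" for u v
    using gh_eq[of "poly2 X u v" "poly2 Y u v"] unfolding G[of u v] H[of u v] uv .
  moreover have "G \<notin> range const2"
    by (rule transfer[OF gh(1) G])
  moreover have "H \<notin> range const2"
    by (rule transfer[OF gh(2) H])
  moreover have "degree (map_poly cnj P) > 0" using assms(1) by (simp add: degree_map_poly)
  ultimately show "\<exists>d P1. d > 1 \<and> P = P1 ^ d"
    by (intro is_power_if_separated_factor[OF assms(1), of "map_poly cnj P" G H])
next
  assume "\<exists>(d::nat) P1. d > 1 \<and> P = P1 ^ d"
  then obtain d P1 where d: "(d::nat) > 1" and P: "P = P1 ^ d" by blast
  have deg: "degree P1 > 0" 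
    using degree_power_le[of P1 d] assms(1) P by (cases "degree P1 = 0") auto
  define R where "R = subst2 P1 (var_x + const2 \<i> * var_y) *
    subst2 (map_poly cnj P1) (var_x - const2 \<i> * var_y)"
  \<comment> \<open>Conjugating coefficients commutes with powers, so both factors of the curve are
    \<open>d\<close>-th powers.\<close>
  have "complexify f = R ^ d - 1"
    unfolding assms(2) by (intro poly2_eqI) (simp add: R_def P power_mult_distrib)
  moreover have "reducible_over_C (R ^ d - 1)"
    using deg d by (intro reducible_if_is_power[of P1 "map_poly cnj P1"])
      (auto simp: R_def map_poly_eq_0_iff)
  ultimately show "reducible_over_C (complexify f)" by simp
qed

end
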